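(* Let $\mathbb{K}$ be $\mathbb{R}$, $\mathbb{C}$, or the quaternions $\mathbb{H}$, and let $\mathcal{D}_L$ be a left diagonal scale function. For an $m\times n$ matrix $A$ over $\mathbb{K}$, define $$A^{-L}:=\left(\mathcal{D}_L[A]\cdot A\right)^{+}\cdot\mathcal{D}_L[A],$$ where $(\cdot)^{+}$ is the Moore-Penrose inverse. Then for every $m\times n$ matrix $A$ and every nonsingular $m\times m$ diagonal matrix $D$ over $\mathbb{K}$: $$A\,A^{-L}A=A,\qquad A^{-L}A\,A^{-L}=A^{-L},\qquad (DA)^{-L}=A^{-L}D^{-1},\qquad \operatorname{rank}[A^{-L}]=\operatorname{rank}[A].$$
   Context: Matrices are over $\mathbb{K}\in\{\mathbb{R},\mathbb{C},\mathbb{H}\}$. A positive diagonal matrix is a diagonal matrix whose diagonal entries are strictly positive reals. A unitary diagonal matrix is a diagonal matrix over $\mathbb{K}$ whose diagonal entries have magnitude $1$. "Conformant" means of a size such that the products make sense. A left diagonal scale function is a function $\mathcal{D}_L$ assigning to each $m\times n$ matrix $A$ an $m\times m$ positive diagonal matrix $\mathcal{D}_L[A]$ such that, for all conformant positive diagonal matrices $D_+$, unitary diagonal matrices $D_u$, permutation matrices $P$, and unitary matrices $U$: (1) $\mathcal{D}_L[D_+A]\cdot(D_+A)=\mathcal{D}_L[A]\cdot A$; (2) $\mathcal{D}_L[D_uA]=\mathcal{D}_L[A]$; (3) $\mathcal{D}_L[PA]=P\,\mathcal{D}_L[A]\,P^{T}$; (4) $\mathcal{D}_L[AU]=\mathcal{D}_L[A]$.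 *)

theory Defs
  imports "HOL-Analysis.Analysis"
begin

section \<open>Quaternions\<close>

datatype quat = Quat (qRe: real) (qI: real) (qJ: real) (qK: real)

lemma quat_eq_iff:
  "x = y \<longleftrightarrow> qRe x = qRe y \<and> qI x = qI y \<and> qJ x = qJ y \<and> qK x = qK y"
  by (cases x; cases y) auto

instantiation quat :: ring_1
begin

definition "0 = Quat 0 0 0 0"
definition "1 = Quat 1 0 0 0"
definition "x + y = Quat (qRe x + qRe y) (qI x + qI y) (qJ x + qJ y) (qK x + qK y)"
definition "- x = Quat (- qRe x) (- qI x) (- qJ x) (- qK x)"
definition "x - y = Quat (qRe x - qRe y) (qI x - qI y) (qJ x - qJ y) (qK x - qK y)"
definition "x * y = Quat
  (qRe x * qRe y - qI x * qI y - qJ x * qJ y - qK x * qK y)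
  (qRe x * qI y + qI x * qRe y + qJ x * qK y - qK x * qJ y)
  (qRe x * qJ y - qI x * qK y + qJ x * qRe y + qK x * qI y)
  (qRe x * qK y + qI x * qJ y - qJ x * qI y + qK x * qRe y)"

lemmas quat_ring_defs = zero_quat_def one_quat_def plus_quat_def uminus_quat_def
  minus_quat_def times_quat_def

instance
  by standard (simp_all add: quat_ring_defs quat_eq_iff algebra_simps)

end

instantiation quat :: real_algebra_1
begin

definition "scaleR r x = Quat (r * qRe x) (r * qI x) (r * qJ x) (r * qK x)"

instance
  by standard (simp_all add: quat_ring_defs scaleR_quat_def quat_eq_iff algebra_simps)

end

instantiation quat :: real_inner
begin

definition "inner x y = qRe x * qRe y + qI x * qI y + qJ x * qJ y + qK x * qK y"
definition "norm (x::quat) = sqrt (inner x x)"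
definition "sgn (x::quat) = x /\<^sub>R norm x"
definition "dist (x::quat) y = norm (x - y)"
definition "(uniformity :: (quat \<times> quat) filter) = (INF e\<in>{0 <..}. principal {(x, y). dist x y < e})"
definition "open (U :: quat set) \<longleftrightarrow> (\<forall>x\<in>U. eventually (\<lambda>(x', y). x' = x \<longrightarrow> y \<in> U) uniformity)"

instance
proof
  fix x y z :: quat and r :: real
  show "inner x y = inner y x"
    by (simp add: inner_quat_def algebra_simps)
  show "inner (x + y) z = inner x z + inner y z"
    by (simp add: inner_quat_def plus_quat_def algebra_simps)
  show "inner (r *\<^sub>R x) y = r * inner x y"
    by (simp add: inner_quat_def scaleR_quat_def algebra_simps)
  show "0 \<le> inner x x"
    by (simp add: inner_quat_def)
  show "inner x x = 0 \<longleftrightarrow> x = 0"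
    by (auto simp: inner_quat_def zero_quat_def quat_eq_iff add_nonneg_eq_0_iff)
qed (rule norm_quat_def sgn_quat_def dist_quat_def open_quat_def uniformity_quat_def)+

end

lemma inner_quat_mult: "inner (x * y) (x * y) = inner x x * inner y (y::quat)"
  by (simp add: inner_quat_def times_quat_def algebra_simps)

instantiation quat :: real_normed_div_algebra
begin

definition "inverse x = Quat (qRe x) (- qI x) (- qJ x) (- qK x) /\<^sub>R inner x x"
definition "x div (y::quat) = x * inverse y"

instance
proof
  fix x y :: quat
  have c: "Quat (qRe x) (- qI x) (- qJ x) (- qK x) * x = inner x x *\<^sub>R 1"
    "x * Quat (qRe x) (- qI x) (- qJ x) (- qK x) = inner x x *\<^sub>R 1"
    by (simp_all add: quat_eq_iff inner_quat_def times_quat_def scaleR_quat_def one_quat_def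
        algebra_simps)
  show "inverse x * x = 1" "x * inverse x = 1" if "x \<noteq> 0"
    using that by (simp_all add: inverse_quat_def c)
  show "x div y = x * inverse y"
    by (rule divide_quat_def)
  show "inverse 0 = (0::quat)"
    by (simp add: inverse_quat_def)
  show "norm (x * y) = norm x * norm y"
    by (simp add: norm_quat_def inner_quat_mult real_sqrt_mult)
qed

end


section \<open>Scalars with conjugation\<close>

class conj_algebra = real_normed_div_algebra +
  fixes conjg :: "'a \<Rightarrow> 'a"
  assumes conjg_add: "conjg (x + y) = conjg x + conjg y"
    and conjg_mult: "conjg (x * y) = conjg y * conjg x"
    and conjg_conjg: "conjg (conjg x) = x"
    and conjg_mult_self: "conjg x * x = (norm x)\<^sup>2 *\<^sub>R 1"

instantiation real :: conj_algebra
begin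

definition "conjg (x::real) = x"

instance
  by standard (simp_all add: conjg_real_def power2_eq_square)

end

instantiation complex :: conj_algebra
begin

definition "conjg (z::complex) = cnj z"

instance
proof
  fix x :: complex
  show "conjg x * x = (norm x)\<^sup>2 *\<^sub>R 1"
    by (metis complex_norm_square conjg_complex_def mult.commute scaleR_conv_of_real mult_1_right)
qed (simp_all add: conjg_complex_def)

end

instantiation quat :: conj_algebra
begin

definition "conjg q = Quat (qRe q) (- qI q) (- qJ q) (- qK q)"

instance
proof
  fix x y :: quat
  have "(norm x)\<^sup>2 = inner x x"
    by (rule power2_norm_eq_inner)
  then show "conjg x * x = (norm x)\<^sup>2 *\<^sub>R 1"
    by (simp add: conjg_quat_def inner_quat_def times_quat_def one_quat_def scaleR_quat_def)
qed (simp_all add: conjg_quat_def plus_quat_def times_quat_def quat_eq_iff)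

end


section \<open>Matrices\<close>

definition conj_transpose :: "'k::conj_algebra^'n^'m \<Rightarrow> 'k^'m^'n"
  where "conj_transpose A = (\<chi> i j. conjg (A $ j $ i))"

definition unitary_matrix :: "'k::conj_algebra^'n^'n \<Rightarrow> bool"
  where "unitary_matrix U \<longleftrightarrow> conj_transpose U ** U = mat 1 \<and> U ** conj_transpose U = mat 1"

definition diagonal_matrix :: "'k::zero^'n^'n \<Rightarrow> bool"
  where "diagonal_matrix D \<longleftrightarrow> (\<forall>i j. i \<noteq> j \<longrightarrow> D $ i $ j = 0)"

definition positive_diagonal_matrix :: "'k::conj_algebra^'n^'n \<Rightarrow> bool"
  where "positive_diagonal_matrix D \<longleftrightarrow>
    diagonal_matrix D \<and> (\<forall>i. \<exists>r::real. 0 < r \<and> D $ i $ i = of_real r)"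

definition unitary_diagonal_matrix :: "'k::conj_algebra^'n^'n \<Rightarrow> bool"
  where "unitary_diagonal_matrix D \<longleftrightarrow> diagonal_matrix D \<and> (\<forall>i. norm (D $ i $ i) = 1)"

definition permutation_matrix :: "'k::conj_algebra^'n^'n \<Rightarrow> bool"
  where "permutation_matrix P \<longleftrightarrow>
    (\<exists>p. bij p \<and> P = (\<chi> i j. if j = p i then 1 else 0))"

definition is_moore_penrose :: "'k::conj_algebra^'n^'m \<Rightarrow> 'k^'m^'n \<Rightarrow> bool"
  where "is_moore_penrose A X \<longleftrightarrow>
    A ** X ** A = A \<and> X ** A ** X = X \<and>
    conj_transpose (A ** X) = A ** X \<and> conj_transpose (X ** A) = X ** A"

definition moore_penrose :: "'k::conj_algebra^'n^'m \<Rightarrow> 'k^'m^'n"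
  where "moore_penrose A = (THE X. is_moore_penrose A X)"

text \<open>
  The library's \<^const>\<open>rank\<close> needs commutative scalars.  The rank of a quaternionic matrix is
  the dimension of its right column space, i.e. the largest number of columns that are linearly
  independent when scalars act on the right.
\<close>

definition right_independent_columns :: "quat^'n^'m \<Rightarrow> 'n set \<Rightarrow> bool"
  where "right_independent_columns A S \<longleftrightarrow>
    (\<forall>c. (\<forall>i. (\<Sum>j\<in>S. A $ i $ j * c j) = 0) \<longrightarrow> (\<forall>j\<in>S. c j = 0))"

definition quat_rank :: "quat^'n^'m \<Rightarrow> nat"
  where "quat_rank A = Max {card S |S. right_independent_columns A S}"


section \<open>Diagonal scale functions and the induced inverse\<close>

definition left_diagonal_scale :: "('k::conj_algebra^'n^'m \<Rightarrow> 'k^'m^'m) \<Rightarrow> bool"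
  where "left_diagonal_scale DL \<longleftrightarrow>
    (\<forall>A. positive_diagonal_matrix (DL A)) \<and>
    (\<forall>A D. positive_diagonal_matrix D \<longrightarrow> DL (D ** A) ** (D ** A) = DL A ** A) \<and>
    (\<forall>A D. unitary_diagonal_matrix D \<longrightarrow> DL (D ** A) = DL A) \<and>
    (\<forall>A P. permutation_matrix P \<longrightarrow> DL (P ** A) = P ** DL A ** transpose P) \<and>
    (\<forall>A U. unitary_matrix U \<longrightarrow> DL (A ** U) = DL A)"

definition left_scale_inverse ::
    "('k::conj_algebra^'n^'m \<Rightarrow> 'k^'m^'m) \<Rightarrow> 'k^'n^'m \<Rightarrow> 'k^'m^'n"
  where "left_scale_inverse DL A = moore_penrose (DL A ** A) ** DL A"

end

theory Submission
  imports Defs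
begin

text \<open>
  Every matrix over a division ring has an inner inverse, so \<open>A\<^sup>* A\<close> and \<open>A A\<^sup>*\<close> do, and since
  \<open>A\<^sup>* A X = 0\<close> forces \<open>A X = 0\<close>, these yield the Moore-Penrose inverse without any spectral
  theory. For unit consistency write \<open>D = D\<^sub>+ D\<^sub>u\<close>, \<open>E = \<D>\<^sub>L[A]\<close>, \<open>F = \<D>\<^sub>L[D A]\<close> and \<open>M = E A\<close>;
  the axioms give \<open>F D\<^sub>+ A = E A\<close>. This determines \<open>F\<close> only on the nonzero rows of \<open>A\<close>, which
  suffices because \<open>M\<^sup>+ = M\<^sup>+ (M\<^sup>+)\<^sup>* M\<^sup>*\<close> vanishes on the columns that belong to zero rows.
  The ranks agree because \<open>X A X = X\<close> bounds the rank of \<open>X\<close> by that of \<open>A\<close>.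
\<close>

section \<open>Inner inverses over division rings\<close>

lemma matrix_sub_ldistrib: "A ** (B - C) = A ** B - A ** (C::'a::ring_1^'p^'n)"
  by (simp add: matrix_matrix_mult_def vec_eq_iff right_diff_distrib sum_subtractf)

lemma matrix_sub_rdistrib: "(A - B) ** C = A ** C - (B::'a::ring_1^'n^'m) ** C"
  by (simp add: matrix_matrix_mult_def vec_eq_iff left_diff_distrib sum_subtractf)

lemma matrix_add_rdistrib: "(A + B) ** C = A ** C + (B::'a::semiring_1^'n^'m) ** C"
  by (simp add: matrix_matrix_mult_def vec_eq_iff distrib_right sum.distrib)

text \<open>Put \<open>R = A - A ** X ** A\<close>. Since \<open>A ** (mat 1 - X ** A)\<close> and
  \<open>(mat 1 - A ** X) ** A\<close> both equal \<open>R\<close>, the correction added to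
  \<open>X\<close> contributes \<open>R ** C ** R = R\<close>, exactly what
  \<open>A ** X ** A\<close> misses.\<close>

lemma inner_inverse_from_remainder:
  fixes A :: "'a::ring_1^'n^'m"
  assumes "(A - A ** X ** A) ** C ** (A - A ** X ** A) = A - A ** X ** A"
  shows "A ** (X + (mat 1 - X ** A) ** C ** (mat 1 - A ** X)) ** A = A"
proof -
  have "A ** (mat 1 - X ** A) = A - A ** X ** A" "(mat 1 - A ** X) ** A = A - A ** X ** A"
    by (simp_all add: matrix_sub_ldistrib matrix_sub_rdistrib matrix_mul_assoc)
  then have "A ** ((mat 1 - X ** A) ** C ** (mat 1 - A ** X)) ** A = A - A ** X ** A"
    using assms by (metis matrix_mul_assoc)
  then show ?thesis
    by (simp add: matrix_add_ldistrib matrix_add_rdistrib)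
qed

text \<open>Gaussian elimination as an induction on the number of nonzero rows. It only divides by a
  pivot and never commutes scalars, so it covers the quaternions.\<close>

lemma ex_inner_inverse:
  fixes A :: "'a::division_ring^'n^'m"
  shows "\<exists>X. A ** X ** A = A"
proof (induction "card {i. A $ i \<noteq> 0}" arbitrary: A rule: less_induct)
  case less
  show ?case
  proof (cases "A = 0")
    case True
    then show ?thesis
      by (auto simp: matrix_matrix_mult_def vec_eq_iff)
  next
    case False
    then obtain i j where ij: "A $ i $ j \<noteq> 0"
      by (auto simp: vec_eq_iff)
    \<comment> \<open>Subtracting \<open>A X A\<close> is an elimination step with pivot \<open>A\<^bsub>ij\<^esub>\<close>: it clears row \<open>i\<close> and keeps zero rows.\<close>
    define X :: "'a^'m^'n"
      where "X = (\<chi> k l. if k = j \<and> l = i then inverse (A $ i $ j) else 0)"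
    have AX: "(A ** X) $ k $ l = (if l = i then A $ k $ j * inverse (A $ i $ j) else 0)" for k l
      by (auto simp: matrix_matrix_mult_def X_def if_distrib[of "\<lambda>x. _ * x"] cong: if_cong)
    have AXA: "(A ** X ** A) $ k $ l = A $ k $ j * inverse (A $ i $ j) * A $ i $ l" for k l
      by (subst matrix_matrix_mult_def)
        (simp add: AX if_distrib[of "\<lambda>x. x * _"] cong: if_cong)
    have row_i: "(A - A ** X ** A) $ i = 0"
      using ij by (simp add: vec_eq_iff AXA)
    have row_0: "(A - A ** X ** A) $ k = 0" if "A $ k = 0" for k
      using that by (simp add: vec_eq_iff AXA)
    have "i \<in> {k. A $ k \<noteq> 0}"
      using ij by auto
    with row_i row_0 have "{k. (A - A ** X ** A) $ k \<noteq> 0} \<subset> {k. A $ k \<noteq> 0}"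
      by blast
    then have "card {k. (A - A ** X ** A) $ k \<noteq> 0} < card {k. A $ k \<noteq> 0}"
      by (intro psubset_card_mono) auto
    from less[OF this] show ?thesis
      using inner_inverse_from_remainder by blast
  qed
qed


section \<open>The Moore-Penrose inverse\<close>

lemma conjg_zero [simp]: "conjg (0::'a::conj_algebra) = 0"
  using conjg_add[of 0 "0::'a"] by simp

lemma conjg_one [simp]: "conjg (1::'a::conj_algebra) = 1"
  using conjg_mult_self[of "1::'a"] by simp

lemma conjg_sum: "conjg (sum f S) = (\<Sum>x\<in>S. conjg (f x :: 'a::conj_algebra))"
  by (induction S rule: infinite_finite_induct) (simp_all add: conjg_add)

text \<open>The class axioms do not state real linearity of \<open>conjg\<close>; here the norm
  identity gives \<open>conjg r * r = r * r\<close>, and a nonzero \<open>r\<close> cancels.\<close>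

lemma conjg_of_real [simp]: "conjg (of_real r :: 'a::conj_algebra) = of_real r"
proof (cases "r = 0")
  case False
  have "conjg (of_real r :: 'a) * of_real r = of_real r * of_real r"
    by (simp add: conjg_mult_self scaleR_conv_of_real power2_eq_square flip: of_real_mult)
  with False show ?thesis
    by simp
qed simp

lemma conj_transpose_conj_transpose [simp]: "conj_transpose (conj_transpose A) = A"
  by (simp add: conj_transpose_def conjg_conjg vec_eq_iff)

lemma conj_transpose_mult: "conj_transpose (A ** B) = conj_transpose B ** conj_transpose A"
  by (simp add: conj_transpose_def matrix_matrix_mult_def conjg_sum conjg_mult vec_eq_iff)

text \<open>The diagonal entries of the product are the sums of squared norms over the columns of
  \<open>A\<close>.\<close>

lemma conj_transpose_mult_self_eq_0:
  assumes "conj_transpose A ** A = 0"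
  shows "A = 0"
proof -
  have "A $ i $ j = 0" for i j
  proof -
    have "(conj_transpose A ** A) $ j $ j = of_real (\<Sum>k\<in>UNIV. (norm (A $ k $ j))\<^sup>2)"
      by (simp add: matrix_matrix_mult_def conj_transpose_def conjg_mult_self scaleR_conv_of_real)
    with assms have "(\<Sum>k\<in>UNIV. (norm (A $ k $ j))\<^sup>2) = 0"
      by (metis of_real_eq_0_iff zero_index)
    then show ?thesis
      by (simp add: sum_nonneg_eq_0_iff)
  qed
  then show ?thesis
    by (simp add: vec_eq_iff)
qed

text \<open>Apply the previous lemma to \<open>A ** (X - Y)\<close>, whose Gram matrix has the
  vanishing difference of the two hypothesised sides as right factor.\<close>

lemma conj_transpose_mult_cancel:
  assumes "conj_transpose A ** A ** X = conj_transpose A ** A ** Y"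
  shows "A ** X = A ** Y"
proof -
  have "conj_transpose (A ** (X - Y)) ** (A ** (X - Y))
      = conj_transpose (X - Y) ** (conj_transpose A ** A ** X - conj_transpose A ** A ** Y)"
    by (simp only: conj_transpose_mult matrix_sub_ldistrib[symmetric] matrix_mul_assoc)
  also have "\<dots> = 0"
    using assms by (simp add: matrix_matrix_mult_def vec_eq_iff)
  finally have "A ** (X - Y) = 0"
    by (rule conj_transpose_mult_self_eq_0)
  then show ?thesis
    by (simp add: matrix_sub_ldistrib)
qed

text \<open>The witness is \<open>G ** ?H\<close> with \<open>G\<close> an inner inverse of
  \<open>?H ** A\<close>. Cancelling \<open>?H\<close> gives \<open>A ** G ** ?H ** A = A\<close>;
  inserting the adjoint of this identity into \<open>A ** G ** ?H\<close> shows that it equals its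
  own adjoint.\<close>

lemma ex_least_squares_inverse:
  fixes A :: "'k::conj_algebra^'n^'m"
  shows "\<exists>X. A ** X ** A = A \<and> conj_transpose (A ** X) = A ** X"
proof -
  let ?H = "conj_transpose A"
  obtain G where "?H ** A ** G ** (?H ** A) = ?H ** A"
    using ex_inner_inverse by blast
  then have "?H ** A ** (G ** ?H ** A) = ?H ** A ** mat 1"
    by (simp add: matrix_mul_assoc)
  then have inner: "A ** G ** ?H ** A = A"
    by (metis conj_transpose_mult_cancel matrix_mul_assoc matrix_mul_rid)
  then have "?H = ?H ** A ** conj_transpose G ** ?H"
    by (metis conj_transpose_conj_transpose conj_transpose_mult matrix_mul_assoc)
  then have "A ** G ** ?H = A ** G ** ?H ** A ** conj_transpose G ** ?H"
    by (metis matrix_mul_assoc)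
  also have "\<dots> = conj_transpose (A ** G ** ?H)"
    by (simp add: inner conj_transpose_mult matrix_mul_assoc)
  finally show ?thesis
    using inner by (metis matrix_mul_assoc)
qed

text \<open>\<open>Y\<close> makes \<open>A ** Y\<close> self-adjoint; \<open>Z\<close>, found by
  passing to the adjoint of \<open>A\<close>, makes \<open>Z ** A\<close> self-adjoint. The product
  \<open>Z ** A ** Y\<close> inherits both symmetries, as it acts like \<open>Y\<close> to the right
  of \<open>A\<close> and like \<open>Z\<close> to its left.\<close>

lemma ex_moore_penrose:
  fixes A :: "'k::conj_algebra^'n^'m"
  shows "\<exists>X. is_moore_penrose A X"
proof -
  obtain Y where Y: "A ** Y ** A = A" "conj_transpose (A ** Y) = A ** Y"
    using ex_least_squares_inverse by blast
  obtain Z' where Z': "conj_transpose A ** Z' ** conj_transpose A = conj_transpose A"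
    "conj_transpose (conj_transpose A ** Z') = conj_transpose A ** Z'"
    using ex_least_squares_inverse by blast
  define Z where "Z = conj_transpose Z'"
  have Z: "A ** Z ** A = A" "conj_transpose (Z ** A) = Z ** A"
    unfolding Z_def using Z'
    by (metis conj_transpose_conj_transpose conj_transpose_mult matrix_mul_assoc)+
  let ?X = "Z ** A ** Y"
  have X: "A ** ?X = A ** Y" "?X ** A = Z ** A"
    using Y(1) Z(1) by (metis matrix_mul_assoc)+
  then have "is_moore_penrose A ?X"
    unfolding is_moore_penrose_def using Y Z by (metis matrix_mul_assoc)
  then show ?thesis
    by blast
qed

text \<open>Taking adjoints in \<open>A ** X = (A ** Y) ** (A ** X)\<close> swaps the self-adjoint
  factors and yields \<open>A ** X = A ** Y\<close>; symmetrically \<open>X ** A = Y ** A\<close>.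
  Then \<open>X = X ** A ** X = Y ** A ** Y = Y\<close>.\<close>

lemma is_moore_penrose_unique:
  assumes "is_moore_penrose A X" "is_moore_penrose A Y"
  shows "X = Y"
proof -
  have X: "A ** X ** A = A" "X ** A ** X = X"
    "conj_transpose (A ** X) = A ** X" "conj_transpose (X ** A) = X ** A"
    and Y: "A ** Y ** A = A" "Y ** A ** Y = Y"
    "conj_transpose (A ** Y) = A ** Y" "conj_transpose (Y ** A) = Y ** A"
    using assms by (auto simp: is_moore_penrose_def)
  have "A ** X = conj_transpose ((A ** Y) ** (A ** X))"
    by (metis X(3) Y(1) matrix_mul_assoc)
  also have "\<dots> = A ** X ** (A ** Y)"
    by (simp only: conj_transpose_mult[of "A ** Y"] X(3) Y(3))
  also have "\<dots> = A ** Y"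
    using X(1) by (metis matrix_mul_assoc)
  finally have AX: "A ** X = A ** Y" .
  have "X ** A = conj_transpose ((X ** A) ** (Y ** A))"
    by (metis X(4) Y(1) matrix_mul_assoc)
  also have "\<dots> = Y ** A ** (X ** A)"
    by (simp only: conj_transpose_mult[of "X ** A"] X(4) Y(4))
  also have "\<dots> = Y ** A"
    using X(1) by (metis matrix_mul_assoc)
  finally have XA: "X ** A = Y ** A" .
  show ?thesis
    by (metis AX XA X(2) Y(2) matrix_mul_assoc)
qed

lemma is_moore_penrose_moore_penrose: "is_moore_penrose A (moore_penrose A)"
  unfolding moore_penrose_def
  by (rule theI') (use ex_moore_penrose is_moore_penrose_unique in blast)

lemma moore_penrose_eqI: "is_moore_penrose A X \<Longrightarrow> moore_penrose A = X"
  using is_moore_penrose_moore_penrose is_moore_penrose_unique by blast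

text \<open>Replace \<open>A ** X\<close> by its adjoint in \<open>X = X ** (A ** X)\<close>. Thus
  an equality of products with \<open>conj_transpose A\<close> on the left carries over to
  \<open>moore_penrose A\<close>.\<close>

lemma moore_penrose_eq_mult_conj_transpose:
  "moore_penrose A = moore_penrose A ** conj_transpose (moore_penrose A) ** conj_transpose A"
  using is_moore_penrose_moore_penrose[of A]
  by (metis conj_transpose_mult is_moore_penrose_def matrix_mul_assoc)

text \<open>Passing from \<open>A\<close> to \<open>U ** A\<close> leaves \<open>?X ** A\<close>
  unchanged and conjugates \<open>A ** ?X\<close> by \<open>U\<close>, so the four Penrose equations
  persist.\<close>

lemma moore_penrose_unitary_mult:
  assumes "conj_transpose U ** U = mat 1"
  shows "moore_penrose (U ** A) = moore_penrose A ** conj_transpose U"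
proof (rule moore_penrose_eqI)
  let ?X = "moore_penrose A"
  have X: "A ** ?X ** A = A" "?X ** A ** ?X = ?X"
    "conj_transpose (A ** ?X) = A ** ?X" "conj_transpose (?X ** A) = ?X ** A"
    using is_moore_penrose_moore_penrose[of A] by (auto simp: is_moore_penrose_def)
  have 1: "?X ** conj_transpose U ** (U ** A) = ?X ** A"
    by (metis assms matrix_mul_assoc matrix_mul_rid)
  have 2: "U ** A ** (?X ** conj_transpose U) = U ** (A ** ?X) ** conj_transpose U"
    by (simp add: matrix_mul_assoc)
  show "is_moore_penrose (U ** A) (?X ** conj_transpose U)"
    unfolding is_moore_penrose_def
  proof (intro conjI)
    show "U ** A ** (?X ** conj_transpose U) ** (U ** A) = U ** A"
      by (metis 1 X(1) matrix_mul_assoc)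
    show "?X ** conj_transpose U ** (U ** A) ** (?X ** conj_transpose U) = ?X ** conj_transpose U"
      by (metis 1 X(2) matrix_mul_assoc)
    show "conj_transpose (U ** A ** (?X ** conj_transpose U)) = U ** A ** (?X ** conj_transpose U)"
      unfolding 2 conj_transpose_mult[of "U ** (A ** ?X)"] conj_transpose_mult[of U] X(3)
      by (simp add: matrix_mul_assoc)
    show "conj_transpose (?X ** conj_transpose U ** (U ** A)) = ?X ** conj_transpose U ** (U ** A)"
      by (simp only: 1 X(4))
  qed
qed


section \<open>Diagonal matrices\<close>

lemma diagonal_matrix_mult_nth:
  fixes D :: "'a::semiring_1^'m^'m"
  assumes "diagonal_matrix D"
  shows "(D ** A) $ i $ j = D $ i $ i * A $ i $ j"
proof -
  have "(D ** A) $ i $ j = (\<Sum>k\<in>UNIV. if k = i then D $ i $ i * A $ i $ j else 0)"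
    unfolding matrix_matrix_mult_def vec_lambda_beta
    using assms by (intro sum.cong) (auto simp: diagonal_matrix_def)
  then show ?thesis
    by simp
qed

lemma diagonal_matrix_mult:
  fixes D :: "'a::semiring_1^'m^'m"
  assumes "diagonal_matrix D" "diagonal_matrix D'"
  shows "diagonal_matrix (D ** D')"
  using assms by (auto simp: diagonal_matrix_def diagonal_matrix_mult_nth[OF assms(1)])

lemma diagonal_matrix_conj_transpose: "diagonal_matrix D \<Longrightarrow> diagonal_matrix (conj_transpose D)"
  by (auto simp: diagonal_matrix_def conj_transpose_def)

lemma positive_diagonal_matrix_mult:
  assumes "positive_diagonal_matrix D" "positive_diagonal_matrix D'"
  shows "positive_diagonal_matrix (D ** D')"
  using assms unfolding positive_diagonal_matrix_def
  by (metis diagonal_matrix_mult diagonal_matrix_mult_nth mult_pos_pos of_real_mult)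

text \<open>Diagonal quaternionic matrices need not commute; here the entries of \<open>D\<close>
  are real and hence central.\<close>

lemma positive_diagonal_matrix_commute:
  fixes D E :: "'k::conj_algebra^'m^'m"
  assumes D: "positive_diagonal_matrix D" and E: "diagonal_matrix E"
  shows "D ** E = E ** D"
proof -
  have D': "diagonal_matrix D"
    using D by (simp add: positive_diagonal_matrix_def)
  have "D $ i $ i * E $ i $ j = E $ i $ i * D $ i $ j" for i j
  proof (cases "i = j")
    case True
    obtain r where "D $ i $ i = of_real r"
      using D by (auto simp: positive_diagonal_matrix_def)
    then show ?thesis
      using True by (simp add: of_real_def)
  next
    case False
    then show ?thesis
      using D' E by (simp add: diagonal_matrix_def)
  qed
  then show ?thesis
    by (simp add: vec_eq_iff diagonal_matrix_mult_nth D' E)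
qed

lemma positive_diagonal_matrix_self_adjoint:
  assumes "positive_diagonal_matrix D"
  shows "conj_transpose D = D"
proof -
  have "conjg (D $ j $ i) = D $ i $ j" for i j
    using assms unfolding positive_diagonal_matrix_def diagonal_matrix_def
    by (cases "i = j") (auto, metis conjg_of_real)
  then show ?thesis
    by (simp add: conj_transpose_def vec_eq_iff)
qed

lemma positive_diagonal_matrix_cancel:
  assumes "positive_diagonal_matrix E" "E ** A = E ** B"
  shows "A = B"
proof -
  have "E $ i $ i \<noteq> 0" for i
    using assms(1) unfolding positive_diagonal_matrix_def
    by (metis less_irrefl of_real_eq_0_iff)
  moreover have "E $ i $ i * A $ i $ j = E $ i $ i * B $ i $ j" for i j
    using assms by (metis diagonal_matrix_mult_nth positive_diagonal_matrix_def)
  ultimately show ?thesis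
    by (simp add: vec_eq_iff)
qed

lemma unitary_diagonal_matrix_conj_transpose_mult:
  assumes "unitary_diagonal_matrix U"
  shows "conj_transpose U ** U = mat 1"
proof -
  have U: "diagonal_matrix U" "norm (U $ i $ i) = 1" for i
    using assms by (auto simp: unitary_diagonal_matrix_def)
  have "conjg (U $ i $ i) * U $ i $ j = (if i = j then 1 else 0)" for i j
    using U(1) conjg_mult_self[of "U $ i $ i"] by (auto simp: diagonal_matrix_def U(2))
  then have "(conj_transpose U ** U) $ i $ j = mat 1 $ i $ j" for i j
    unfolding diagonal_matrix_mult_nth[OF diagonal_matrix_conj_transpose[OF U(1)]]
    by (simp only: conj_transpose_def mat_def vec_lambda_beta)
  then show ?thesis
    by (simp add: vec_eq_iff)
qed

text \<open>Entrywise this is \<open>d = norm d * sgn d\<close>; invertibility makes every diagonal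
  entry nonzero, so that \<open>sgn d\<close> has norm 1.\<close>

lemma diagonal_matrix_polar_decomposition:
  fixes D :: "'k::conj_algebra^'m^'m"
  assumes D: "diagonal_matrix D" and "invertible D"
  obtains P U where "positive_diagonal_matrix P" "unitary_diagonal_matrix U" "D = P ** U"
proof
  have nz: "D $ i $ i \<noteq> 0" for i
  proof
    assume "D $ i $ i = 0"
    moreover obtain D' where "D ** D' = mat 1"
      using \<open>invertible D\<close> by (auto simp: invertible_def)
    ultimately show False
      using diagonal_matrix_mult_nth[OF D, of D' i i] by (simp add: mat_def)
  qed
  define P :: "'k^'m^'m" where "P = (\<chi> i j. if i = j then of_real (norm (D $ i $ i)) else 0)"
  define U :: "'k^'m^'m" where "U = (\<chi> i j. if i = j then sgn (D $ i $ i) else 0)"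
  have P: "diagonal_matrix P"
    by (simp add: P_def diagonal_matrix_def)
  show "positive_diagonal_matrix P"
    unfolding positive_diagonal_matrix_def using P nz
    by (auto simp: P_def intro!: exI[of _ "norm (D $ _ $ _)"])
  show "unitary_diagonal_matrix U"
    using nz by (simp add: unitary_diagonal_matrix_def diagonal_matrix_def U_def norm_sgn)
  show "D = P ** U"
    using D nz by (auto simp: vec_eq_iff diagonal_matrix_mult_nth[OF P])
      (auto simp: P_def U_def diagonal_matrix_def sgn_div_norm of_real_def)
qed


section \<open>The inverse induced by a left diagonal scale function\<close>

text \<open>After left multiplication by \<open>DL A\<close> this is the first Penrose equation for
  \<open>DL A ** A\<close>.\<close>

lemma left_scale_inverse_inner:
  assumes "left_diagonal_scale DL"
  shows "A ** left_scale_inverse DL A ** A = A"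
proof (rule positive_diagonal_matrix_cancel)
  show "positive_diagonal_matrix (DL A)"
    using assms by (simp add: left_diagonal_scale_def)
  show "DL A ** (A ** left_scale_inverse DL A ** A) = DL A ** A"
    using is_moore_penrose_moore_penrose[of "DL A ** A"]
    by (simp add: left_scale_inverse_def is_moore_penrose_def matrix_mul_assoc)
qed

lemma left_scale_inverse_outer:
  "left_scale_inverse DL A ** A ** left_scale_inverse DL A = left_scale_inverse DL A"
  using is_moore_penrose_moore_penrose[of "DL A ** A"]
  unfolding left_scale_inverse_def is_moore_penrose_def by (metis matrix_mul_assoc)

lemma left_scale_inverse_diagonal_mult:
  fixes A :: "'k::conj_algebra^'n^'m"
  assumes DL: "left_diagonal_scale DL" and D: "diagonal_matrix D" and inv: "invertible D"
  shows "left_scale_inverse DL (D ** A) = left_scale_inverse DL A ** matrix_inv D"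
proof -
  obtain P U where P: "positive_diagonal_matrix P" and U: "unitary_diagonal_matrix U"
    and D_eq: "D = P ** U"
    using diagonal_matrix_polar_decomposition[OF D inv] .
  define E where "E = DL A"
  define F where "F = DL (D ** A)"
  define M where "M = E ** A"
  have E: "positive_diagonal_matrix E" and F: "positive_diagonal_matrix F"
    using DL by (simp_all add: left_diagonal_scale_def E_def F_def)
  have dU: "diagonal_matrix U"
    using U by (simp add: unitary_diagonal_matrix_def)
  have UU: "conj_transpose U ** U = mat 1"
    by (rule unitary_diagonal_matrix_conj_transpose_mult[OF U])
  have FP: "positive_diagonal_matrix (F ** P)"
    by (rule positive_diagonal_matrix_mult[OF F P])
  \<comment> \<open>Axiom (1) removes the positive factor \<open>P\<close>, and axiom (2) then
    removes \<open>U\<close> from the argument of \<open>DL\<close>.\<close>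
  have "F ** (D ** A) = DL (U ** A) ** (U ** A)"
    using DL P unfolding F_def D_eq left_diagonal_scale_def by (metis matrix_mul_assoc)
  also have "DL (U ** A) = E"
    using DL U by (simp add: left_diagonal_scale_def E_def)
  also have "E ** (U ** A) = U ** M"
    unfolding M_def by (metis positive_diagonal_matrix_commute[OF E dU] matrix_mul_assoc)
  finally have FDA: "F ** (D ** A) = U ** M" .
  \<comment> \<open>A second expression for the same product; comparing the two and cancelling
    \<open>U\<close> gives \<open>F ** P ** A = E ** A\<close>.\<close>
  have "F ** (D ** A) = U ** (F ** P ** A)"
    unfolding D_eq by (metis positive_diagonal_matrix_commute[OF FP dU] matrix_mul_assoc)
  with FDA have "U ** (F ** P ** A) = U ** M"
    by simp
  then have FPA: "F ** P ** A = M"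
    by (metis UU matrix_mul_assoc matrix_mul_lid)
  have comm: "F ** P ** E = E ** (F ** P)"
    using positive_diagonal_matrix_commute[OF FP] E by (simp add: positive_diagonal_matrix_def)
  \<comment> \<open>\<open>F ** P\<close> and \<open>E\<close> may differ on zero rows of
    \<open>A\<close>, but they agree after multiplication by the adjoint of \<open>M\<close>,
    because \<open>F ** P ** E ** A = E ** (F ** P ** A) = E ** M\<close>. The agreement passes on
    to \<open>moore_penrose M\<close>.\<close>
  have "conj_transpose M ** (F ** P) = conj_transpose (F ** P ** M)"
    by (simp only: conj_transpose_mult[of "F ** P"] positive_diagonal_matrix_self_adjoint[OF FP])
  also have "F ** P ** M = E ** M"
    using comm FPA unfolding M_def by (metis matrix_mul_assoc)
  also have "conj_transpose (E ** M) = conj_transpose M ** E"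
    by (simp only: conj_transpose_mult positive_diagonal_matrix_self_adjoint[OF E])
  finally have "moore_penrose M ** (F ** P) = moore_penrose M ** E"
    by (metis moore_penrose_eq_mult_conj_transpose matrix_mul_assoc)
  \<comment> \<open>The real diagonal matrix \<open>F ** P\<close> commutes with the adjoint of
    \<open>U\<close>, which then meets the \<open>U\<close> in \<open>D = P ** U\<close>.\<close>
  moreover have "conj_transpose U ** F ** D = F ** P"
    unfolding D_eq
    using positive_diagonal_matrix_commute[OF FP diagonal_matrix_conj_transpose[OF dU]] UU
    by (metis matrix_mul_assoc matrix_mul_rid)
  moreover have "left_scale_inverse DL (D ** A) = moore_penrose M ** conj_transpose U ** F"
    unfolding left_scale_inverse_def
    by (simp add: FDA[unfolded F_def] moore_penrose_unitary_mult[OF UU] F_def)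
  ultimately have "left_scale_inverse DL (D ** A) ** D = left_scale_inverse DL A"
    unfolding left_scale_inverse_def[of DL A] E_def[symmetric] M_def[symmetric]
    by (metis matrix_mul_assoc)
  moreover have "D ** matrix_inv D = mat 1"
    using someI_ex[OF inv[unfolded invertible_def]] by (simp add: matrix_inv_def)
  ultimately show ?thesis
    by (metis matrix_mul_assoc matrix_mul_rid)
qed


section \<open>Ranks of outer inverses\<close>

text \<open>Each row \<open>x\<close> of \<open>X\<close> satisfies
  \<open>x = (x v* A) v* X\<close>, so the rows of \<open>X\<close> lie in the image of the row
  space of \<open>A\<close> under a linear map.\<close>

lemma rank_outer_inverse_le:
  fixes A :: "'a::field^'n^'m"
  assumes "X ** A ** X = X"
  shows "rank X \<le> rank A"
proof -
  let ?f = "\<lambda>w. w v* X"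
  interpret f: Vector_Spaces.linear "(*s)" "(*s)" ?f
    by unfold_locales
      (simp_all add: vec_eq_iff vector_matrix_mult_def sum.distrib sum_distrib_left algebra_simps)
  have "rows X \<subseteq> ?f ` vec.span (rows A)"
  proof
    fix v assume "v \<in> rows X"
    then obtain i where v: "v = row i X"
      by (auto simp: rows_def)
    have "row i X v* A = (\<Sum>k\<in>UNIV. X $ i $ k *s row k A)"
      by (simp add: vec_eq_iff vector_matrix_mult_def row_def mult.commute)
    also have "\<dots> \<in> vec.span (rows A)"
      by (intro vec.span_sum vec.span_scale vec.span_base) (auto simp: rows_def)
    finally have "row i X v* A \<in> vec.span (rows A)" .
    moreover have "?f (row i X v* A) = v"
    proof -
      have "row i X v* (A ** X) = row i (X ** (A ** X))"
        by (simp add: vec_eq_iff vector_matrix_mult_def matrix_matrix_mult_def row_def mult.commute)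
      then show ?thesis
        using assms v by (simp add: vector_matrix_mul_assoc matrix_mul_assoc)
    qed
    ultimately show "v \<in> ?f ` vec.span (rows A)"
      by (metis imageI)
  qed
  then have "vec.dim (rows X) \<le> vec.dim (?f ` vec.span (rows A))"
    by (rule vec.dim_subset)
  also have "\<dots> \<le> vec.dim (vec.span (rows A))"
    by (rule vec.dim_image_le[OF f.linear_axioms])
  finally show ?thesis
    by (simp add: row_rank_def_gen)
qed

section \<open>Linear systems and column rank over the quaternions\<close>

lemma underdetermined_system:
  fixes C :: "'i \<Rightarrow> 'j \<Rightarrow> 'a::division_ring"
  assumes "finite T" "finite S" "card T < card S"
  shows "\<exists>c. (\<exists>j\<in>S. c j \<noteq> 0) \<and> (\<forall>i\<in>T. (\<Sum>j\<in>S. C i j * c j) = 0)"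
  using assms
proof (induction T arbitrary: S C rule: finite_induct)
  case empty
  then have "S \<noteq> {}"
    by auto
  then obtain j where "j \<in> S"
    by blast
  then show ?case
    by (intro exI[of _ "\<lambda>_. 1"]) auto
next
  case (insert t T)
  show ?case
  proof (cases "\<forall>j\<in>S. C t j = 0")
    case True
    moreover have "card T < card S"
      using insert.prems insert.hyps by simp
    from insert.IH[OF insert.prems(1) this, of C] obtain c
      where "\<exists>j\<in>S. c j \<noteq> 0" "\<forall>i\<in>T. (\<Sum>j\<in>S. C i j * c j) = 0"
      by blast
    ultimately show ?thesis
      by (intro exI[of _ c]) simp
  next
    case False
    then obtain k where k: "k \<in> S" "C t k \<noteq> 0"
      by blast
    \<comment> \<open>Coefficients act from the left, so equation \<open>t\<close> is normalised by
      a left inverse of its pivot: \<open>c k + (\<Sum>j\<in>S - {k}. q j * c j) = 0\<close>.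
      Substituting for unknown \<open>k\<close> leaves a system with one equation and one unknown
      fewer.\<close>
    define q where "q j = inverse (C t k) * C t j" for j
    have "card T < card (S - {k})"
      using insert.prems insert.hyps k by simp
    then obtain c where c: "\<exists>j\<in>S - {k}. c j \<noteq> 0"
      and eq: "\<forall>i\<in>T. (\<Sum>j\<in>S - {k}. (C i j - C i k * q j) * c j) = 0"
      using insert.IH[of "S - {k}" "\<lambda>i j. C i j - C i k * q j"] insert.prems(1) by blast
    \<comment> \<open>Back substitution: the value at \<open>k\<close> is the one forced by equation
      \<open>t\<close>.\<close>
    define d where "d j = (if j = k then - (\<Sum>j\<in>S - {k}. q j * c j) else c j)" for j
    have d: "(\<Sum>j\<in>S. C i j * d j) = (\<Sum>j\<in>S - {k}. (C i j - C i k * q j) * c j)" for i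
    proof -
      have "(\<Sum>j\<in>S. C i j * d j) = C i k * d k + (\<Sum>j\<in>S - {k}. C i j * d j)"
        by (rule sum.remove[OF insert.prems(1) k(1)])
      also have "(\<Sum>j\<in>S - {k}. C i j * d j) = (\<Sum>j\<in>S - {k}. C i j * c j)"
        by (intro sum.cong) (auto simp: d_def)
      also have "C i k * d k = - (\<Sum>j\<in>S - {k}. C i k * q j * c j)"
        unfolding d_def by (simp only: simp_thms if_True mult_minus_right sum_distrib_left mult.assoc)
      finally show ?thesis
        unfolding left_diff_distrib sum_subtractf by simp
    qed
    have "C t j - C t k * q j = 0" for j
      using k by (simp add: q_def flip: mult.assoc)
    then have "(\<Sum>j\<in>S. C t j * d j) = 0"
      unfolding d by (simp only: mult_zero_left sum.neutral_const)
    then have "\<forall>i\<in>insert t T. (\<Sum>j\<in>S. C i j * d j) = 0"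
      using eq unfolding d by blast
    moreover have "\<exists>j\<in>S. d j \<noteq> 0"
      using c by (auto simp: d_def)
    ultimately show ?thesis
      by blast
  qed
qed

lemma
  fixes A :: "quat^'n^'m"
  shows card_le_quat_rank: "right_independent_columns A S \<Longrightarrow> card S \<le> quat_rank A"
    and quat_rank_attained: "\<exists>S. right_independent_columns A S \<and> card S = quat_rank A"
proof -
  let ?N = "{card S |S. right_independent_columns A S}"
  have fin: "finite ?N"
    by (rule finite_subset[of _ "range card"]) auto
  show "right_independent_columns A S \<Longrightarrow> card S \<le> quat_rank A"
    unfolding quat_rank_def using fin by (intro Max_ge) auto
  have "right_independent_columns A {}"
    by (simp add: right_independent_columns_def)
  then have "?N \<noteq> {}"
    by blast
  then have "quat_rank A \<in> ?N"
    unfolding quat_rank_def using fin by (intro Max_in)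
  then show "\<exists>S. right_independent_columns A S \<and> card S = quat_rank A"
    by auto
qed

text \<open>A rank factorisation: a largest independent set \<open>T\<close> of columns spans the
  others, with coefficients on the right.\<close>

lemma quat_column_basis:
  fixes A :: "quat^'n^'m"
  obtains T C where "card T = quat_rank A" "\<And>i j. A $ i $ j = (\<Sum>k\<in>T. A $ i $ k * C k j)"
proof -
  obtain T where T: "right_independent_columns A T" "card T = quat_rank A"
    using quat_rank_attained by blast
  have "\<exists>c. \<forall>i. A $ i $ j = (\<Sum>k\<in>T. A $ i $ k * c k)" for j
  proof (cases "j \<in> T")
    case True
    then show ?thesis
      by (intro exI[of _ "\<lambda>k. if k = j then 1 else 0"])
        (simp add: if_distrib[of "\<lambda>x. _ * x"] cong: if_cong)
  next
    case False
    have "\<not> right_independent_columns A (insert j T)"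
      using card_le_quat_rank[of A "insert j T"] T(2) False by auto
    then obtain c k where c: "\<And>i. (\<Sum>k\<in>insert j T. A $ i $ k * c k) = 0"
      and k: "k \<in> insert j T" "c k \<noteq> 0"
      by (auto simp: right_independent_columns_def)
    have c': "A $ i $ j * c j = - (\<Sum>k\<in>T. A $ i $ k * c k)" for i
      using c[of i] False by (simp add: eq_neg_iff_add_eq_0)
    \<comment> \<open>With \<open>c j = 0\<close> the relation would involve only the independent
      columns in \<open>T\<close>. Hence it can be solved for column \<open>j\<close> by dividing on
      the right.\<close>
    have nz: "c j \<noteq> 0"
    proof
      assume "c j = 0"
      then have "\<forall>i. (\<Sum>k\<in>T. A $ i $ k * c k) = 0"
        using c' by simp
      with T(1) have "\<forall>k\<in>T. c k = 0"
        unfolding right_independent_columns_def by blast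
      with k \<open>c j = 0\<close> show False
        by auto
    qed
    have "A $ i $ j = (\<Sum>k\<in>T. A $ i $ k * (- c k * inverse (c j)))" for i
    proof -
      have "A $ i $ j = A $ i $ j * c j * inverse (c j)"
        using nz by (simp add: mult.assoc)
      also have "\<dots> = (\<Sum>k\<in>T. A $ i $ k * (- c k * inverse (c j)))"
        by (simp add: c' sum_distrib_right sum_negf mult.assoc)
      finally show ?thesis .
    qed
    then show ?thesis
      by (intro exI[of _ "\<lambda>k. - c k * inverse (c j)"] allI)
  qed
  then have "\<exists>C. \<forall>j i. A $ i $ j = (\<Sum>k\<in>T. A $ i $ k * C j k)"
    by (intro choice allI)
  then obtain C where "\<And>i j. A $ i $ j = (\<Sum>k\<in>T. A $ i $ k * C j k)"
    by blast
  then show thesis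
    by (intro that[of T "\<lambda>k j. C j k"] T(2))
qed

text \<open>The product factors through the \<open>card T\<close> basis columns of \<open>A\<close>,
  with coefficient matrix \<open>K\<close>. More than \<open>card T\<close> columns of
  \<open>A ** B\<close> would admit a nonzero \<open>c\<close> annihilated by \<open>K\<close>,
  hence a dependency.\<close>

lemma quat_rank_mult_le_left:
  fixes A :: "quat^'n^'m"
  shows "quat_rank (A ** B) \<le> quat_rank A"
proof -
  obtain T C where T: "card T = quat_rank A"
    and C: "\<And>i j. A $ i $ j = (\<Sum>k\<in>T. A $ i $ k * C k j)"
    by (rule quat_column_basis) blast
  obtain S where S: "right_independent_columns (A ** B) S" "card S = quat_rank (A ** B)"
    using quat_rank_attained by blast
  define K where "K k j = (\<Sum>l\<in>UNIV. C k l * B $ l $ j)" for k j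
  have AB: "(A ** B) $ i $ j = (\<Sum>k\<in>T. A $ i $ k * K k j)" for i j
  proof -
    have "(A ** B) $ i $ j = (\<Sum>l\<in>UNIV. \<Sum>k\<in>T. A $ i $ k * (C k l * B $ l $ j))"
      unfolding matrix_matrix_mult_def vec_lambda_beta
    proof (rule sum.cong[OF refl])
      fix l
      have "A $ i $ l * B $ l $ j = (\<Sum>k\<in>T. A $ i $ k * C k l) * B $ l $ j"
        by (rule arg_cong[OF C])
      then show "A $ i $ l * B $ l $ j = (\<Sum>k\<in>T. A $ i $ k * (C k l * B $ l $ j))"
        by (simp only: sum_distrib_right mult.assoc)
    qed
    also have "\<dots> = (\<Sum>k\<in>T. A $ i $ k * K k j)"
      by (subst sum.swap) (simp add: K_def sum_distrib_left)
    finally show ?thesis .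
  qed
  have "\<not> card T < card S"
  proof
    assume "card T < card S"
    then obtain c where c: "\<exists>j\<in>S. c j \<noteq> 0" "\<forall>k\<in>T. (\<Sum>j\<in>S. K k j * c j) = 0"
      using underdetermined_system[of T S K] by auto
    have "(\<Sum>j\<in>S. (A ** B) $ i $ j * c j) = 0" for i
    proof -
      have "(\<Sum>j\<in>S. (A ** B) $ i $ j * c j) = (\<Sum>j\<in>S. \<Sum>k\<in>T. A $ i $ k * (K k j * c j))"
        by (simp add: AB sum_distrib_right mult.assoc)
      also have "\<dots> = (\<Sum>k\<in>T. A $ i $ k * (\<Sum>j\<in>S. K k j * c j))"
        by (subst sum.swap) (simp add: sum_distrib_left)
      finally show ?thesis
        using c(2) by simp
    qed
    with S(1) c(1) show False
      unfolding right_independent_columns_def by blast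
  qed
  with T S(2) show ?thesis
    by simp
qed

text \<open>A right dependency among columns of \<open>B\<close> is also one among the same columns
  of \<open>A ** B\<close>.\<close>

lemma quat_rank_mult_le_right:
  fixes A :: "quat^'n^'m"
  shows "quat_rank (A ** B) \<le> quat_rank B"
proof -
  obtain S where S: "right_independent_columns (A ** B) S" "card S = quat_rank (A ** B)"
    using quat_rank_attained by blast
  have "(\<Sum>j\<in>S. (A ** B) $ i $ j * c j) = (\<Sum>k\<in>UNIV. A $ i $ k * (\<Sum>j\<in>S. B $ k $ j * c j))"
    for c i
    by (simp add: matrix_matrix_mult_def sum_distrib_left sum_distrib_right mult.assoc)
      (rule sum.swap)
  with S(1) have "right_independent_columns B S"
    by (simp add: right_independent_columns_def)
  with S(2) show ?thesis
    using card_le_quat_rank[of B S] by simp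
qed

text \<open>Read \<open>X\<close> as \<open>(X ** A) ** X\<close>: its rank is at most that of
  \<open>X ** A\<close>, hence at most that of \<open>A\<close>.\<close>

lemma quat_rank_outer_inverse_le:
  fixes A :: "quat^'n^'m"
  assumes "X ** A ** X = X"
  shows "quat_rank X \<le> quat_rank A"
  using assms quat_rank_mult_le_left[of "X ** A" X] quat_rank_mult_le_right[of X A]
  by simp

text \<open>\<open>A\<close> and its induced inverse are outer inverses of each other, so the rank
  bound applies in both directions.\<close>

lemma rank_left_scale_inverse:
  fixes A :: "'k::{conj_algebra,field}^'n^'m"
  assumes "left_diagonal_scale DL"
  shows "rank (left_scale_inverse DL A) = rank A"
  using rank_outer_inverse_le[OF left_scale_inverse_outer]
    rank_outer_inverse_le[OF left_scale_inverse_inner[OF assms]]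
  by (rule antisym)

lemma quat_rank_left_scale_inverse:
  assumes "left_diagonal_scale DL"
  shows "quat_rank (left_scale_inverse DL A) = quat_rank A"
  using quat_rank_outer_inverse_le[OF left_scale_inverse_outer]
    quat_rank_outer_inverse_le[OF left_scale_inverse_inner[OF assms]]
  by (rule antisym)

theorem mainTheorem2:
  shows
    "(\<forall>(DL :: real^'n^'m \<Rightarrow> real^'m^'m) A D.
        left_diagonal_scale DL \<and> diagonal_matrix D \<and> invertible D \<longrightarrow>
          A ** left_scale_inverse DL A ** A = A \<and>
          left_scale_inverse DL A ** A ** left_scale_inverse DL A = left_scale_inverse DL A \<and>
          left_scale_inverse DL (D ** A) = left_scale_inverse DL A ** matrix_inv D \<and>
          rank (left_scale_inverse DL A) = rank A) \<and>
     (\<forall>(DL :: complex^'n^'m \<Rightarrow> complex^'m^'m) A D.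
        left_diagonal_scale DL \<and> diagonal_matrix D \<and> invertible D \<longrightarrow>
          A ** left_scale_inverse DL A ** A = A \<and>
          left_scale_inverse DL A ** A ** left_scale_inverse DL A = left_scale_inverse DL A \<and>
          left_scale_inverse DL (D ** A) = left_scale_inverse DL A ** matrix_inv D \<and>
          rank (left_scale_inverse DL A) = rank A) \<and>
     (\<forall>(DL :: quat^'n^'m \<Rightarrow> quat^'m^'m) A D.
        left_diagonal_scale DL \<and> diagonal_matrix D \<and> invertible D \<longrightarrow>
          A ** left_scale_inverse DL A ** A = A \<and>
          left_scale_inverse DL A ** A ** left_scale_inverse DL A = left_scale_inverse DL A \<and>
          left_scale_inverse DL (D ** A) = left_scale_inverse DL A ** matrix_inv D \<and>
          quat_rank (left_scale_inverse DL A) = quat_rank A)"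
  by (intro conjI allI impI; elim conjE)
    (simp_all add: left_scale_inverse_inner left_scale_inverse_outer
      left_scale_inverse_diagonal_mult rank_left_scale_inverse quat_rank_left_scale_inverse)

end
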